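(* Let $S$ be a subring of a finite ring $R$. Then $$\frac{1}{M_S}\left(1+\frac{M_S-1}{|S:Z(S,R)|}\right)\leq \mathrm{Pr}(S,R)\leq \frac{1}{m_S}\left(1+\frac{m_S-1}{|S:Z(S,R)|}\right).$$ The equality holds if and only if $m_S=M_S=|[x,R]|$ for all $x\in S\setminus Z(S,R)$.
   Context: For elements $x,y$ of a ring $R$, $[x,y]=xy-yx$. For a subring $S$ of a finite ring $R$, $$\mathrm{Pr}(S,R)=\frac{|\{(x,y)\in S\times R : [x,y]=0\}|}{|S||R|}.$$ $Z(S,R)=\{x\in S : xy=yx \text{ for all } y\in R\}$, and $|S:Z(S,R)|$ is the index of $Z(S,R)$ in $S$ as additive groups. For $x\in S$, $[x,R]=\{[x,y] : y\in R\}$, an additive subgroup of $R$. For any subring $S$ of $R$, $m_S=\min\{|[x,R]| : x\in S\setminus Z(S,R)\}$ and $M_S=\max\{|[x,R]| : x\in S\setminus Z(S,R)\}$. *)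

theory Defs
  imports Complex_Main
begin

text \<open>
  The finite ring \<open>R\<close> is a type of class \<open>{ring, finite}\<close>. The class \<open>ring\<close> does not require
  a multiplicative identity; likewise a subring need not contain one.
\<close>

definition subring :: "'a::ring set \<Rightarrow> bool" where
  "subring S \<longleftrightarrow> 0 \<in> S \<and> (\<forall>x\<in>S. \<forall>y\<in>S. x - y \<in> S) \<and> (\<forall>x\<in>S. \<forall>y\<in>S. x * y \<in> S)"

definition commutator :: "'a::ring \<Rightarrow> 'a \<Rightarrow> 'a" where
  "commutator x y = x * y - y * x"

definition commuting_prob :: "'a::{ring, finite} set \<Rightarrow> real" where
  "commuting_prob S =
     real (card {(x, y). x \<in> S \<and> y \<in> (UNIV :: 'a set) \<and> commutator x y = 0}) /
     (real (card S) * real (card (UNIV :: 'a set)))"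

definition rel_center :: "'a::ring set \<Rightarrow> 'a set" where
  "rel_center S = {x \<in> S. \<forall>y. x * y = y * x}"

text \<open>The index \<open>|S : H|\<close> of additive groups: the number of cosets \<open>x + H\<close> with \<open>x \<in> S\<close>.\<close>

definition add_index :: "'a::ring set \<Rightarrow> 'a set \<Rightarrow> nat" where
  "add_index S H = card ((\<lambda>x. (\<lambda>h. x + h) ` H) ` S)"

definition commutator_set :: "'a::ring \<Rightarrow> 'a set" where
  "commutator_set x = {commutator x y | y. True}"

text \<open>
  If \<open>S = Z(S,R)\<close>, the minimum and maximum range over the empty set; both are then taken to
  be 1, the common value of \<open>|[x,R]|\<close> for the elements \<open>x\<close> of \<open>S\<close> in that case.
\<close>

definition min_comm :: "'a::{ring, finite} set \<Rightarrow> nat" where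
  "min_comm S =
     (if S - rel_center S = {} then 1
      else Min {card (commutator_set x) | x. x \<in> S - rel_center S})"

definition max_comm :: "'a::{ring, finite} set \<Rightarrow> nat" where
  "max_comm S =
     (if S - rel_center S = {} then 1
      else Max {card (commutator_set x) | x. x \<in> S - rel_center S})"

end

theory Submission
  imports Defs
begin

text \<open>
  Write \<open>c x = |[x,R]|\<close>, \<open>Z = Z(S,R)\<close> and \<open>E = S - Z\<close>, and let \<open>m\<close> and \<open>M\<close> be the extremal
  values of \<open>c\<close> on \<open>E\<close>. The map \<open>y \<mapsto> [x,y]\<close> is additive with
  image \<open>[x,R]\<close> and kernel the centralizer of \<open>x\<close>, so \<open>x\<close> commutes with a proportion \<open>1 / c x\<close>
  of \<open>R\<close>, and \<open>Pr(S,R)\<close> is the average of \<open>1 / c x\<close> over \<open>x \<in> S\<close>. The elements of \<open>Z\<close> are those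
  with \<open>c x = 1\<close>; they contribute \<open>|Z|\<close> to the sum, which gives
  \<open>|S| Pr(S,R) = |Z| + (\<Sum>x\<in>E. 1 / c x)\<close> (\<open>commuting_prob_center_split\<close>).

  By Lagrange's theorem \<open>|S| = |S:Z| |Z|\<close>, and therefore the expression
  \<open>(1 / t) (1 + (t - 1) / |S:Z|)\<close> is the value that this formula yields for \<open>Pr(S,R)\<close> when
  every \<open>c x\<close> with \<open>x \<in> E\<close> is replaced by \<open>t\<close> (\<open>bound_center_split\<close>). Since \<open>m \<le> c x \<le> M\<close> on \<open>E\<close>, both
  inequalities follow by comparing two sums term by term, and such a comparison is an equality
  exactly when all terms agree. For either bound this says that \<open>c\<close> is constant on \<open>E\<close>, which
  forces \<open>m = M\<close>; hence both equality cases have the same description.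
\<close>

text \<open>
  The counting principle behind Lagrange's theorem. It serves twice: for the cosets of \<open>Z(S,R)\<close>
  in \<open>S\<close>, and for the additive map \<open>y \<mapsto> [x,y]\<close>, whose fibres are the cosets of its kernel.
\<close>

lemma card_eq_card_image_mult_coset:
  fixes A K :: "'a::group_add set"
  assumes "finite A" and fibre: "\<And>x. x \<in> A \<Longrightarrow> {y \<in> A. f y = f x} = (\<lambda>h. x + h) ` K"
  shows "card A = card (f ` A) * card K"
proof -
  have "card A = (\<Sum>b\<in>f ` A. card {y \<in> A. f y = b})"
    using sum.image_gen[OF assms(1), of "\<lambda>_. 1::nat" f] by simp
  also have "\<dots> = (\<Sum>b\<in>f ` A. card K)"
    by (rule sum.cong) (auto simp: fibre card_image)
  finally show ?thesis by simp
qed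

lemma add_rel_center_in_subring:
  assumes "subring S" "x \<in> S" "h \<in> rel_center S"
  shows "x + h \<in> S"
proof -
  have "0 - h \<in> S" using assms by (auto simp: subring_def rel_center_def)
  then have "x - (0 - h) \<in> S" using assms unfolding subring_def by blast
  then show ?thesis by simp
qed

lemma rel_center_diff:
  assumes "subring S" "h \<in> rel_center S" "k \<in> rel_center S"
  shows "h - k \<in> rel_center S"
  using assms by (auto simp: subring_def rel_center_def algebra_simps)

lemma zero_in_rel_center: "subring S \<Longrightarrow> 0 \<in> rel_center S"
  by (simp add: subring_def rel_center_def)

lemma rel_center_coset_eq_iff:
  assumes S: "subring S"
  shows "(\<lambda>h. y + h) ` rel_center S = (\<lambda>h. x + h) ` rel_center S
    \<longleftrightarrow> y \<in> (\<lambda>h. x + h) ` rel_center S"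
proof
  assume "(\<lambda>h. y + h) ` rel_center S = (\<lambda>h. x + h) ` rel_center S"
  moreover have "y \<in> (\<lambda>h. y + h) ` rel_center S"
    using zero_in_rel_center[OF S] by force
  ultimately show "y \<in> (\<lambda>h. x + h) ` rel_center S" by simp
next
  assume "y \<in> (\<lambda>h. x + h) ` rel_center S"
  then obtain h where h: "h \<in> rel_center S" and y: "y = x + h" by blast
  have "x + k \<in> (\<lambda>h. y + h) ` rel_center S" if "k \<in> rel_center S" for k
    by (rule image_eqI[of _ _ "k - h"]) (auto simp: y rel_center_diff[OF S that h])
  moreover have "y + k \<in> (\<lambda>h. x + h) ` rel_center S" if k: "k \<in> rel_center S" for k
  proof (rule image_eqI)
    show "h - (0 - k) \<in> rel_center S"
      by (intro rel_center_diff S h k zero_in_rel_center)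
    show "y + k = x + (h - (0 - k))" by (simp add: y add.assoc)
  qed
  ultimately show "(\<lambda>h. y + h) ` rel_center S = (\<lambda>h. x + h) ` rel_center S" by blast
qed

lemma card_subring_eq_index_mult:
  fixes S :: "'a::{ring, finite} set"
  assumes "subring S"
  shows "card S = add_index S (rel_center S) * card (rel_center S)"
  unfolding add_index_def
proof (rule card_eq_card_image_mult_coset)
  fix x assume "x \<in> S"
  then show "{y \<in> S. (\<lambda>h. y + h) ` rel_center S = (\<lambda>h. x + h) ` rel_center S}
      = (\<lambda>h. x + h) ` rel_center S"
    using add_rel_center_in_subring[OF assms] by (auto simp: rel_center_coset_eq_iff[OF assms])
qed simp

lemma card_ring_eq_commutator_set_mult_centralizer:
  fixes x :: "'a::{ring, finite}"
  shows "card (UNIV :: 'a set) = card (commutator_set x) * card {y. commutator x y = 0}"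
proof -
  have "{y \<in> UNIV. commutator x y = commutator x z} = (\<lambda>h. z + h) ` {y. commutator x y = 0}"
    for z
  proof -
    have shift: "commutator x y = commutator x z \<longleftrightarrow> commutator x (y - z) = 0" for y
      by (auto simp: commutator_def algebra_simps)
    show ?thesis
    proof (intro set_eqI iffI)
      fix y assume "y \<in> {y \<in> UNIV. commutator x y = commutator x z}"
      then show "y \<in> (\<lambda>h. z + h) ` {y. commutator x y = 0}"
        by (intro image_eqI[of _ _ "y - z"]) (simp_all add: shift)
    qed (auto simp: shift)
  qed
  from card_eq_card_image_mult_coset[OF finite this]
  show ?thesis by (simp add: commutator_set_def full_SetCompr_eq)
qed

lemma card_commutator_set_pos: "card (commutator_set (x :: 'a::{ring, finite})) > 0"
  by (auto simp: card_gt_0_iff commutator_set_def)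

lemma card_commutator_set_center:
  assumes "x \<in> rel_center S"
  shows "card (commutator_set x) = 1"
  using assms by (simp add: rel_center_def commutator_set_def commutator_def)

lemma commuting_prob_eq_average:
  fixes S :: "'a::{ring, finite} set"
  shows "commuting_prob S = (\<Sum>x\<in>S. 1 / real (card (commutator_set x))) / real (card S)"
proof -
  let ?n = "real (card (UNIV :: 'a set))"
  have "{(x, y). x \<in> S \<and> y \<in> (UNIV :: 'a set) \<and> commutator x y = 0}
      = Sigma S (\<lambda>x. {y. commutator x y = 0})" by auto
  then have "real (card {(x, y). x \<in> S \<and> y \<in> (UNIV :: 'a set) \<and> commutator x y = 0})
      = (\<Sum>x\<in>S. real (card {y. commutator x y = 0}))" by simp
  also have "\<dots> = (\<Sum>x\<in>S. ?n * (1 / real (card (commutator_set x))))"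
  proof (rule sum.cong[OF refl])
    fix x :: 'a
    show "real (card {y. commutator x y = 0}) = ?n * (1 / real (card (commutator_set x)))"
      unfolding card_ring_eq_commutator_set_mult_centralizer[of x] of_nat_mult
      using card_commutator_set_pos[of x] by (simp del: card_0_eq)
  qed
  also have "\<dots> = ?n * (\<Sum>x\<in>S. 1 / real (card (commutator_set x)))"
    by (rule sum_distrib_left[symmetric])
  finally show ?thesis by (simp add: commuting_prob_def)
qed

lemma commuting_prob_center_split:
  fixes S :: "'a::{ring, finite} set"
  shows "commuting_prob S =
    (real (card (rel_center S)) + (\<Sum>x\<in>S - rel_center S. 1 / real (card (commutator_set x))))
      / real (card S)"
proof -
  have sub: "rel_center S \<subseteq> S" by (auto simp: rel_center_def)
  have "(\<Sum>x\<in>rel_center S. 1 / real (card (commutator_set x))) = real (card (rel_center S))"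
    by (simp add: card_commutator_set_center)
  then show ?thesis
    by (simp add: commuting_prob_eq_average sum.subset_diff[OF sub])
qed

text \<open>
  Written over the common denominator \<open>|S|\<close>, the bound has the same shape as \<open>Pr(S,R)\<close> in
  \<open>commuting_prob_center_split\<close>; keeping the constant \<open>1 / t\<close> as a sum over the noncentral
  elements allows the two to be compared term by term.
\<close>

lemma bound_center_split:
  fixes S :: "'a::{ring, finite} set" and t :: real
  assumes "subring S" and "t > 0"
  shows "1 / t * (1 + (t - 1) / real (add_index S (rel_center S))) =
    (real (card (rel_center S)) + (\<Sum>x\<in>S - rel_center S. 1 / t)) / real (card S)"
proof -
  let ?i = "real (add_index S (rel_center S))" and ?z = "real (card (rel_center S))"
  have S: "real (card S) = ?i * ?z"
    using card_subring_eq_index_mult[OF assms(1)] by simp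
  have "card S > 0" using assms(1) by (auto simp: subring_def card_gt_0_iff)
  then have pos: "?i > 0" "?z > 0"
    by (simp_all add: card_subring_eq_index_mult[OF assms(1)])
  have sub: "rel_center S \<subseteq> S" by (auto simp: rel_center_def)
  have "real (card (S - rel_center S)) = ?i * ?z - ?z"
    using card_Diff_subset[OF finite sub] card_mono[OF finite sub] S by simp
  then have E: "(\<Sum>x\<in>S - rel_center S. 1 / t) = (?i * ?z - ?z) / t" by simp
  have "1 / t * (1 + (t - 1) / i) = (z + (i * z - z) / t) / (i * z)"
    if "i > 0" "z > 0" for i z :: real
    using that assms(2) by (simp add: divide_simps) (simp add: algebra_simps)
  then show ?thesis unfolding S E using pos by blast
qed

lemma min_comm_le:
  "x \<in> S - rel_center S \<Longrightarrow> min_comm S \<le> card (commutator_set x)"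
  unfolding min_comm_def by (auto intro!: Min_le)

lemma le_max_comm:
  "x \<in> S - rel_center S \<Longrightarrow> card (commutator_set x) \<le> max_comm S"
  unfolding max_comm_def by (auto intro!: Max_ge)

lemma noncentral_cards_eq:
  assumes "S - rel_center S \<noteq> {}" and "\<forall>x\<in>S - rel_center S. card (commutator_set x) = t"
  shows "{card (commutator_set x) | x. x \<in> S - rel_center S} = {t}"
  using assms by (auto intro: exI)

lemma min_comm_pos:
  fixes S :: "'a::{ring, finite} set"
  shows "min_comm S > 0"
proof (cases "S - rel_center S = {}")
  case False
  then have "Min {card (commutator_set x) | x. x \<in> S - rel_center S}
      \<in> {card (commutator_set x) | x. x \<in> S - rel_center S}"
    by (intro Min_in) auto
  then obtain x :: 'a where "min_comm S = card (commutator_set x)"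
    using False unfolding min_comm_def by auto
  then show ?thesis by (simp only: card_commutator_set_pos)
qed (simp add: min_comm_def)

lemma max_comm_pos: "max_comm S > 0"
proof (cases "S - rel_center S = {}")
  case False
  then obtain x where "x \<in> S - rel_center S" by blast
  from card_commutator_set_pos le_max_comm[OF this] show ?thesis by (rule less_le_trans)
qed (simp add: max_comm_def)

text \<open>
  If \<open>S\<close> has no noncentral elements, the hypothesis is vacuous and \<open>t\<close> carries no information;
  the two extremal values then agree because both default to 1.
\<close>

lemma min_comm_eq_max_comm_if_constant:
  assumes "\<forall>x\<in>S - rel_center S. card (commutator_set x) = t"
  shows "min_comm S = max_comm S"
  using noncentral_cards_eq[OF _ assms] by (simp add: min_comm_def max_comm_def)

lemma sum_eq_iff_pointwise_if_le:
  fixes f g :: "'b \<Rightarrow> real"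
  assumes "finite E" and "\<And>x. x \<in> E \<Longrightarrow> f x \<le> g x"
  shows "sum f E = sum g E \<longleftrightarrow> (\<forall>x\<in>E. f x = g x)"
  using sum_mono_inv[of f E g] assms by (auto intro: sum.cong)

theorem theorem3p5:
  fixes S :: "'a::{ring, finite} set"
  assumes "subring S"
  shows "1 / real (max_comm S) *
           (1 + (real (max_comm S) - 1) / real (add_index S (rel_center S)))
         \<le> commuting_prob S
       \<and> commuting_prob S
         \<le> 1 / real (min_comm S) *
           (1 + (real (min_comm S) - 1) / real (add_index S (rel_center S)))
       \<and> (1 / real (max_comm S) *
           (1 + (real (max_comm S) - 1) / real (add_index S (rel_center S)))
         = commuting_prob S
         \<longleftrightarrow> min_comm S = max_comm S \<and>
             (\<forall>x \<in> S - rel_center S. max_comm S = card (commutator_set x)))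
       \<and> (commuting_prob S
         = 1 / real (min_comm S) *
           (1 + (real (min_comm S) - 1) / real (add_index S (rel_center S)))
         \<longleftrightarrow> min_comm S = max_comm S \<and>
             (\<forall>x \<in> S - rel_center S. max_comm S = card (commutator_set x)))"
proof -
  let ?Z = "rel_center S" and ?E = "S - rel_center S"
  let ?c = "\<lambda>x. card (commutator_set x)"
  let ?B = "\<lambda>t::nat. 1 / real t * (1 + (real t - 1) / real (add_index S ?Z))"
  let ?P = "min_comm S = max_comm S \<and> (\<forall>x\<in>?E. max_comm S = ?c x)"
  have N: "real (card S) > 0" using assms by (auto simp: subring_def card_gt_0_iff)
  have B: "?B t = (real (card ?Z) + (\<Sum>x\<in>?E. 1 / real t)) / real (card S)" if "t > 0" for t
    using bound_center_split[OF assms, of "real t"] that by simp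
  have lower: "1 / real (max_comm S) \<le> 1 / real (?c x)" if "x \<in> ?E" for x
    using le_max_comm[OF that] card_commutator_set_pos[of x] by (simp add: frac_le)
  have upper: "1 / real (?c x) \<le> 1 / real (min_comm S)" if "x \<in> ?E" for x
    using min_comm_le[OF that] min_comm_pos[of S] by (simp add: frac_le)
  have "?B (max_comm S) \<le> commuting_prob S"
    unfolding B[OF max_comm_pos] commuting_prob_center_split
    by (intro divide_right_mono add_left_mono sum_mono lower) auto
  moreover have "commuting_prob S \<le> ?B (min_comm S)"
    unfolding B[OF min_comm_pos] commuting_prob_center_split
    by (intro divide_right_mono add_left_mono sum_mono upper) auto
  moreover have "?B (max_comm S) = commuting_prob S \<longleftrightarrow> ?P"
  proof -
    have "?B (max_comm S) = commuting_prob S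
        \<longleftrightarrow> (\<Sum>x\<in>?E. 1 / real (max_comm S)) = (\<Sum>x\<in>?E. 1 / real (?c x))"
      unfolding B[OF max_comm_pos] commuting_prob_center_split using N by auto
    also have "\<dots> \<longleftrightarrow> (\<forall>x\<in>?E. 1 / real (max_comm S) = 1 / real (?c x))"
      using lower by (intro sum_eq_iff_pointwise_if_le) auto
    also have "\<dots> \<longleftrightarrow> (\<forall>x\<in>?E. ?c x = max_comm S)" by auto
    also have "\<dots> \<longleftrightarrow> ?P" using min_comm_eq_max_comm_if_constant[of S "max_comm S"] by metis
    finally show ?thesis .
  qed
  moreover have "commuting_prob S = ?B (min_comm S) \<longleftrightarrow> ?P"
  proof -
    have "commuting_prob S = ?B (min_comm S)
        \<longleftrightarrow> (\<Sum>x\<in>?E. 1 / real (?c x)) = (\<Sum>x\<in>?E. 1 / real (min_comm S))"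
      unfolding B[OF min_comm_pos] commuting_prob_center_split using N by auto
    also have "\<dots> \<longleftrightarrow> (\<forall>x\<in>?E. 1 / real (?c x) = 1 / real (min_comm S))"
      using upper by (intro sum_eq_iff_pointwise_if_le) auto
    also have "\<dots> \<longleftrightarrow> (\<forall>x\<in>?E. ?c x = min_comm S)" by auto
    also have "\<dots> \<longleftrightarrow> ?P" using min_comm_eq_max_comm_if_constant[of S "min_comm S"] by metis
    finally show ?thesis .
  qed
  ultimately show ?thesis by blast
qed

end
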